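(* Let $k\ge2$ and let $G$ be a $k$-uniform hypergraph on $n$ vertices. Then the incidence $Q$-tensor $\mathcal{Q}^{*}$ of $G$ is irreducible if and only if $G$ is connected.
   Context: A $k$-uniform hypergraph $G=(V,E)$ has finite vertex set $V=[n]=\{1,\dots,n\}$ and a set $E$ of $k$-element subsets of $V$ (the edges; no repeated edges). A path is a sequence $w_1,f_1,w_2,\dots,w_q,f_q,w_{q+1}$ with distinct vertices $w_j$, distinct edges $f_j$, and $w_j,w_{j+1}\in f_j$ for all $j$; $G$ is connected if any two vertices are joined by a path. The incidence $Q$-tensor $\mathcal{Q}^*$ of $G$ is the order-$k$ dimension-$n$ tensor whose $(i_1,\dots,i_k)$-entry is the number of edges $e$ with $i_t\in e$ for all $t=1,\dots,k$ (indices may repeat). An order-$k$ dimension-$n$ tensor $\mathcal{T}$ is reducible if there is a nonempty proper subset $I\subset[n]$ such that $\mathcal{T}_{i_1i_2\cdots i_k}=0$ for all $i_1\in I$ and all $i_2,\dots,i_k\notin I$; it is irreducible if it is not reducible. *)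

theory Defs
  imports Complex_Main "HOL-Library.FuncSet"
begin

definition uniform_hypergraph :: "nat \<Rightarrow> nat \<Rightarrow> nat set set \<Rightarrow> bool" where
  "uniform_hypergraph k n E \<longleftrightarrow> (\<forall>e\<in>E. e \<subseteq> {1..n} \<and> card e = k)"

(* ws = [w_1, ..., w_(q+1)] and fs = [f_1, ..., f_q], indexed from 0 as lists.
   The case q = 0 (a single vertex) is allowed, so a vertex is joined to itself. *)
definition hypergraph_path ::
    "nat \<Rightarrow> nat set set \<Rightarrow> nat list \<Rightarrow> nat set list \<Rightarrow> bool" where
  "hypergraph_path n E ws fs \<longleftrightarrow>
     length ws = length fs + 1 \<and> set ws \<subseteq> {1..n} \<and> set fs \<subseteq> E \<and>
     distinct ws \<and> distinct fs \<and>
     (\<forall>j<length fs. ws ! j \<in> fs ! j \<and> ws ! Suc j \<in> fs ! j)"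

definition hypergraph_connected :: "nat \<Rightarrow> nat set set \<Rightarrow> bool" where
  "hypergraph_connected n E \<longleftrightarrow>
     (\<forall>u\<in>{1..n}. \<forall>v\<in>{1..n}.
        \<exists>ws fs. hypergraph_path n E ws fs \<and> hd ws = u \<and> last ws = v)"

(* A tensor of order k and dimension n is a function on multi-indices
   i = (i 1, ..., i k), i.e. on {1..k} \<rightarrow>\<^sub>E {1..n}; its values elsewhere are irrelevant. *)
type_synonym tensor = "(nat \<Rightarrow> nat) \<Rightarrow> real"

definition tensor_reducible :: "nat \<Rightarrow> nat \<Rightarrow> tensor \<Rightarrow> bool" where
  "tensor_reducible k n T \<longleftrightarrow>
     (\<exists>I. I \<noteq> {} \<and> I \<subset> {1..n} \<and>
        (\<forall>i \<in> {1..k} \<rightarrow>\<^sub>E {1..n}. i 1 \<in> I \<and> (\<forall>t\<in>{2..k}. i t \<notin> I) \<longrightarrow> T i = 0))"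

definition tensor_irreducible :: "nat \<Rightarrow> nat \<Rightarrow> tensor \<Rightarrow> bool" where
  "tensor_irreducible k n T \<longleftrightarrow> \<not> tensor_reducible k n T"

definition incidence_Q_tensor :: "nat \<Rightarrow> nat set set \<Rightarrow> tensor" where
  "incidence_Q_tensor k E = (\<lambda>i. real (card {e \<in> E. \<forall>t\<in>{1..k}. i t \<in> e}))"

end

theory Submission
  imports Defs
begin

text \<open>
  Both properties say that no nonempty proper set \<open>I\<close> of vertices is a union of components, that is,
  that for every such \<open>I\<close> some edge has vertices both inside and outside \<open>I\<close>.

  For the tensor this is a statement about single entries. An entry with \<open>i\<^sub>1 \<in> I\<close> and
  \<open>i\<^sub>2, \<dots>, i\<^sub>k \<notin> I\<close> can only be nonzero if an edge contains both \<open>i\<^sub>1 \<in> I\<close> and \<open>i\<^sub>2 \<notin> I\<close>.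
  Conversely, an edge through \<open>u \<in> I\<close> and \<open>v \<notin> I\<close> makes the entry \<open>(u, v, \<dots>, v)\<close> positive
  (\<open>tensor_reducible_incidence_iff\<close>).

  For the hypergraph, a path from \<open>I\<close> to its complement has a step that leaves \<open>I\<close>, and the set of
  vertices reachable from a given one absorbs every edge that it meets
  (\<open>reachable_closed_under_edges\<close>). The latter needs care only because the edges and vertices
  of a path have to be distinct.
\<close>

lemma tensor_reducible_incidence_iff:
  assumes "k \<ge> 2" and "uniform_hypergraph k n E"
  shows "tensor_reducible k n (incidence_Q_tensor k E) \<longleftrightarrow>
    (\<exists>I. I \<noteq> {} \<and> I \<subset> {1..n} \<and> (\<forall>e\<in>E. e \<inter> I = {} \<or> e \<subseteq> I))"
proof -
  have E: "e \<subseteq> {1..n}" if "e \<in> E" for e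
    using assms(2) that by (auto simp: uniform_hypergraph_def)
  \<comment> \<open>An entry is a cardinality, which vanishes only for the empty set because \<open>E\<close> is finite.\<close>
  then have "finite E"
    by (intro finite_subset[of E "Pow {1..n}"]) auto
  then have entry_zero: "incidence_Q_tensor k E i = 0 \<longleftrightarrow> (\<forall>e\<in>E. \<exists>t\<in>{1..k}. i t \<notin> e)" for i
    by (auto simp: incidence_Q_tensor_def)
  have "(\<forall>i \<in> {1..k} \<rightarrow>\<^sub>E {1..n}. i 1 \<in> I \<and> (\<forall>t\<in>{2..k}. i t \<notin> I)
           \<longrightarrow> incidence_Q_tensor k E i = 0)
        \<longleftrightarrow> (\<forall>e\<in>E. e \<inter> I = {} \<or> e \<subseteq> I)" (is "?zero \<longleftrightarrow> ?closed")
    for I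
  proof
    assume zero: ?zero
    show ?closed
    proof (rule ccontr)
      assume "\<not> ?closed"
      then obtain e u v where e: "e \<in> E" "u \<in> e" "u \<in> I" "v \<in> e" "v \<notin> I"
        by blast
      define i where "i = (\<lambda>t\<in>{1..k}. if t = 1 then u else v)"
      have "i \<in> {1..k} \<rightarrow>\<^sub>E {1..n}"
        using e E[of e] by (auto simp: i_def)
      moreover have "i 1 \<in> I" "\<forall>t\<in>{2..k}. i t \<notin> I"
        using e assms(1) by (auto simp: i_def)
      ultimately have "incidence_Q_tensor k E i = 0"
        using zero by blast
      moreover have "\<forall>t\<in>{1..k}. i t \<in> e"
        using e by (auto simp: i_def)
      ultimately show False
        using e(1) entry_zero by blast
    qed
  next
    assume closed: ?closed
    show ?zero
    proof (intro ballI impI)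
      fix i
      assume i: "i 1 \<in> I \<and> (\<forall>t\<in>{2..k}. i t \<notin> I)"
      have "\<exists>t\<in>{1..k}. i t \<notin> e" if "e \<in> E" for e
      proof (rule ccontr)
        assume "\<not> (\<exists>t\<in>{1..k}. i t \<notin> e)"
        then have "i 1 \<in> e" "i 2 \<in> e"
          using assms(1) by auto
        moreover have "i 1 \<in> I" "i 2 \<notin> I"
          using i assms(1) by auto
        ultimately show False
          using closed that by blast
      qed
      then show "incidence_Q_tensor k E i = 0"
        using entry_zero by blast
    qed
  qed
  then show ?thesis
    by (simp add: tensor_reducible_def)
qed

lemma path_stays_in_closed_set:
  assumes path: "hypergraph_path n E ws fs"
    and closed: "\<forall>e\<in>E. e \<inter> I = {} \<or> e \<subseteq> I"
    and "hd ws \<in> I"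
  shows "last ws \<in> I"
proof -
  have len: "length ws = length fs + 1" and fs: "set fs \<subseteq> E"
    and inc: "\<forall>j<length fs. ws ! j \<in> fs ! j \<and> ws ! Suc j \<in> fs ! j"
    using path by (auto simp: hypergraph_path_def)
  then have ne: "ws \<noteq> []"
    by auto
  have "j \<le> length fs \<Longrightarrow> ws ! j \<in> I" for j
  proof (induction j)
    case 0
    then show ?case
      using assms(3) ne by (simp add: hd_conv_nth)
  next
    case (Suc j)
    then have "ws ! j \<in> I" "ws ! j \<in> fs ! j" "ws ! Suc j \<in> fs ! j" "fs ! j \<in> E"
      using inc fs nth_mem[of j fs] by auto
    then show ?case
      using closed by blast
  qed
  then show ?thesis
    using ne len by (simp add: last_conv_nth)
qed

lemma hypergraph_path_prefix:
  assumes "hypergraph_path n E ws fs" and "j < length ws"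
  shows "hypergraph_path n E (take (Suc j) ws) (take j fs)"
  using assms set_take_subset[of "Suc j" ws] set_take_subset[of j fs]
  by (auto simp: hypergraph_path_def)

lemma hypergraph_path_snoc:
  assumes "hypergraph_path n E ws fs" and "e \<in> E" "last ws \<in> e" "x \<in> e" "x \<in> {1..n}"
    and "e \<notin> set fs" "x \<notin> set ws"
  shows "hypergraph_path n E (ws @ [x]) (fs @ [e])"
proof -
  have "length ws = Suc (length fs)"
    using assms(1) by (simp add: hypergraph_path_def)
  moreover from this have "last ws = ws ! length fs"
    by (subst last_conv_nth) auto
  ultimately show ?thesis
    using assms by (auto simp: hypergraph_path_def nth_append less_Suc_eq)
qed

lemma reachable_closed_under_edges:
  assumes path: "hypergraph_path n E ws fs" and e: "e \<in> E" "e \<subseteq> {1..n}" "last ws \<in> e" "x \<in> e"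
  shows "\<exists>ws' fs'. hypergraph_path n E ws' fs' \<and> hd ws' = hd ws \<and> last ws' = x"
proof (cases "x \<in> set ws")
  case True
  then obtain j where j: "j < length ws" "ws ! j = x"
    by (auto simp: in_set_conv_nth)
  then have "hypergraph_path n E (take (Suc j) ws) (take j fs)"
    using path by (intro hypergraph_path_prefix)
  moreover have "hd (take (Suc j) ws) = hd ws"
    by simp
  moreover have "last (take (Suc j) ws) = x"
    using j by (simp add: take_Suc_conv_app_nth)
  ultimately show ?thesis
    by blast
next
  case False
  have len: "length ws = length fs + 1"
    and inc: "\<forall>j<length fs. ws ! j \<in> fs ! j \<and> ws ! Suc j \<in> fs ! j"
    using path by (auto simp: hypergraph_path_def)
  \<comment> \<open>The path is cut at its first vertex in \<open>e\<close>; since an edge of the path contains the vertex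
    preceding it, \<open>e\<close> is not among the edges that remain.\<close>
  define j where "j = (LEAST j. j < length ws \<and> ws ! j \<in> e)"
  have "length fs < length ws \<and> ws ! length fs \<in> e"
    using e(3) len by (subst (asm) last_conv_nth) auto
  then have j: "j < length ws" "ws ! j \<in> e"
    using LeastI[of "\<lambda>j. j < length ws \<and> ws ! j \<in> e"] unfolding j_def by blast+
  have before: "ws ! i \<notin> e" if "i < j" for i
    using not_less_Least[of i "\<lambda>j. j < length ws \<and> ws ! j \<in> e"] that j(1)
    unfolding j_def by auto
  have "e \<notin> set (take j fs)"
  proof
    assume "e \<in> set (take j fs)"
    then obtain i where "i < j" "i < length fs" "fs ! i = e"
      by (auto simp: in_set_conv_nth)
    then show False
      using inc before by blast
  qed
  moreover have "x \<notin> set (take (Suc j) ws)"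
    using False by (auto dest: in_set_takeD)
  moreover have "last (take (Suc j) ws) \<in> e"
    using j by (simp add: take_Suc_conv_app_nth)
  ultimately have "hypergraph_path n E (take (Suc j) ws @ [x]) (take j fs @ [e])"
    using path j e by (intro hypergraph_path_snoc hypergraph_path_prefix) auto
  moreover have "hd (take (Suc j) ws @ [x]) = hd ws"
    using j(1) by (cases ws) auto
  ultimately show ?thesis
    by (intro exI[of _ "take (Suc j) ws @ [x]"]) auto
qed

lemma hypergraph_connected_iff:
  assumes edges: "\<And>e. e \<in> E \<Longrightarrow> e \<subseteq> {1..n}"
  shows "hypergraph_connected n E \<longleftrightarrow>
    \<not> (\<exists>I. I \<noteq> {} \<and> I \<subset> {1..n} \<and> (\<forall>e\<in>E. e \<inter> I = {} \<or> e \<subseteq> I))" (is "_ \<longleftrightarrow> \<not> ?split")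
proof
  assume conn: "hypergraph_connected n E"
  show "\<not> ?split"
  proof
    assume ?split
    then obtain I u v where I: "\<forall>e\<in>E. e \<inter> I = {} \<or> e \<subseteq> I"
      and uv: "u \<in> I" "u \<in> {1..n}" "v \<in> {1..n}" "v \<notin> I"
      by blast
    from conn uv obtain ws fs where "hypergraph_path n E ws fs" "hd ws = u" "last ws = v"
      unfolding hypergraph_connected_def by blast
    with path_stays_in_closed_set[OF _ I] uv show False
      by blast
  qed
next
  assume no_split: "\<not> ?split"
  show "hypergraph_connected n E"
    unfolding hypergraph_connected_def
  proof (intro ballI)
    fix u v
    assume u: "u \<in> {1..n}" and v: "v \<in> {1..n}"
    define R where
      "R = {v \<in> {1..n}. \<exists>ws fs. hypergraph_path n E ws fs \<and> hd ws = u \<and> last ws = v}"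
    have "hypergraph_path n E [u] []"
      using u by (simp add: hypergraph_path_def)
    then have "\<exists>ws fs. hypergraph_path n E ws fs \<and> hd ws = u \<and> last ws = u"
      by (intro exI[of _ "[u]"] exI[of _ "[]"]) simp
    then have "u \<in> R"
      using u by (simp add: R_def)
    moreover have "R \<subseteq> {1..n}"
      by (auto simp: R_def)
    moreover have "e \<inter> R = {} \<or> e \<subseteq> R" if "e \<in> E" for e
    proof -
      have "x \<in> R" if "w \<in> e" "w \<in> R" "x \<in> e" for w x
      proof -
        obtain ws fs where "hypergraph_path n E ws fs" "hd ws = u" "last ws = w"
          using \<open>w \<in> R\<close> unfolding R_def by blast
        then have "\<exists>ws fs. hypergraph_path n E ws fs \<and> hd ws = u \<and> last ws = x"
          using reachable_closed_under_edges[of n E ws fs e x] \<open>e \<in> E\<close> edges that by simp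
        then show "x \<in> R"
          using edges[OF \<open>e \<in> E\<close>] \<open>x \<in> e\<close> unfolding R_def by blast
      qed
      then show ?thesis
        by blast
    qed
    ultimately have "R = {1..n}"
      using no_split by blast
    then show "\<exists>ws fs. hypergraph_path n E ws fs \<and> hd ws = u \<and> last ws = v"
      using v unfolding R_def by blast
  qed
qed

theorem lemma11:
  fixes k n :: nat and E :: "nat set set"
  assumes "k \<ge> 2" and "uniform_hypergraph k n E"
  shows "tensor_irreducible k n (incidence_Q_tensor k E) \<longleftrightarrow> hypergraph_connected n E"
proof -
  have "e \<subseteq> {1..n}" if "e \<in> E" for e
    using assms(2) that by (auto simp: uniform_hypergraph_def)
  then show ?thesis
    using tensor_reducible_incidence_iff[OF assms] hypergraph_connected_iff[of E n]
    by (simp add: tensor_irreducible_def)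
qed

end
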